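(* Let $P\in\mathbb{Z}[x]$ be a monic polynomial of degree $d$ with constant coefficient $a_0=\pm1$, let $K=\mathbb{Q}(\alpha_1,\dots,\alpha_d)$ be its splitting field, let $R=\mathcal{O}_K$ be the ring of integers of $K$, and let $m\in\mathbb{Z}_{>1}$. If $n$ is a positive integer divisible by $\#(R/mR)^\times$, then $\Delta(P_n)$ is divisible by $m^{d(d-1)}$.
   Context: $\alpha_1,\dots,\alpha_d$ are the roots of $P$ (with multiplicity). For $n\ge1$, $P_n(x):=\prod_{j=1}^d(x-\alpha_j^n)\in\mathbb{Z}[x]$ and $\Delta(P_n)=\prod_{1\le j<k\le d}(\alpha_j^n-\alpha_k^n)^2\in\mathbb{Z}$ is its discriminant. $(R/mR)^\times$ is the unit group of the finite ring $R/mR$. *)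

theory Defs
  imports
    "HOL-Algebra.Algebraic_Closure_Type"
    "HOL-Algebra.QuotRing"
    "HOL-Algebra.Generated_Fields"
    "HOL-Computational_Algebra.Fundamental_Theorem_Algebra"
    "HOL-Combinatorics.List_Permutation"
begin

definition disc_roots :: "complex list \<Rightarrow> complex" where
  "disc_roots xs = (\<Prod>j<length xs. \<Prod>k\<in>{j<..<length xs}. (xs ! j - xs ! k)^2)"

text \<open>The value does not depend on the chosen order of the roots, see \<open>disc_roots_cong\<close>.\<close>

definition discriminant :: "complex poly \<Rightarrow> complex" where
  "discriminant Q = Polynomial.lead_coeff Q ^ (2 * Polynomial.degree Q - 2) *
     disc_roots (SOME xs. mset xs = proots Q)"

text \<open>If \<open>\<alpha> 1, \<dots>, \<alpha> d\<close> are the roots of \<open>P\<close> with multiplicity, this is \<open>P\<^sub>n\<close>.\<close>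

definition power_poly :: "nat \<Rightarrow> (nat \<Rightarrow> complex) \<Rightarrow> nat \<Rightarrow> complex poly" where
  "power_poly d \<alpha> n = (\<Prod>j=1..d. [:- (\<alpha> j ^ n), 1:])"

lemma disc_roots_alt:
  "disc_roots xs = (\<Prod>(j,k)\<in>{(j,k). j < k \<and> k < length xs}. (xs ! j - xs ! k)^2)"
proof -
  have "Sigma {..<length xs} (\<lambda>j. {j<..<length xs}) = {(j,k). j < k \<and> k < length xs}"
    by auto
  then show ?thesis
    unfolding disc_roots_def by (subst prod.Sigma) auto
qed

lemma disc_roots_cong:
  assumes "mset xs = mset ys"
  shows "disc_roots xs = disc_roots ys"
proof -
  obtain p where p: "p permutes {..<length ys}" "permute_list p ys = xs"
    using assms by (rule mset_eq_permutation)
  define n where "n = length ys"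
  define q where "q = inv_into UNIV p"
  have n: "length xs = n" using p(2) n_def by (metis length_permute_list)
  have inj: "p i = p j \<longleftrightarrow> i = j" for i j
    using p(1) by (metis permutes_inverses(2))
  have lt: "p i < n \<longleftrightarrow> i < n" for i
    using permutes_in_image[OF p(1)] by (simp add: n_def)
  have inv_lt: "q i < n \<longleftrightarrow> i < n" for i
    using permutes_in_image[OF permutes_inv[OF p(1)]] by (simp add: n_def q_def)
  have pinv: "p (q i) = i" "q (p i) = i" for i
    using permutes_inverses[OF p(1)] by (auto simp: q_def)
  let ?S = "{(j,k). j < k \<and> k < n}"
  let ?f = "\<lambda>(j,k). if p j < p k then (p j, p k) else (p k, p j)"
  let ?g = "\<lambda>(j,k). if q j < q k then (q j, q k) else (q k, q j)"
  have ne: "i \<noteq> j \<Longrightarrow> q i \<noteq> q j" for i j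
    by (metis pinv(1))
  have "(\<Prod>(j,k)\<in>?S. (xs ! j - xs ! k)^2) = (\<Prod>(j,k)\<in>?S. (ys ! j - ys ! k)^2)"
  proof (rule prod.reindex_bij_witness[where i = ?g and j = ?f])
    fix a assume a: "a \<in> ?S"
    obtain j k where jk: "a = (j,k)" "j < k" "k < n" using a by auto
    then have [simp]: "xs ! j = ys ! (p j)" "xs ! k = ys ! (p k)"
      using p n_def by (auto simp: permute_list_nth)
    show "?g (?f a) = a" using jk by (auto simp: pinv)
    show "?f a \<in> ?S" using jk lt inj[of j k] by auto
    show "(case ?f a of (j,k) \<Rightarrow> (ys ! j - ys ! k)^2) = (case a of (j,k) \<Rightarrow> (xs ! j - xs ! k)^2)"
      using jk power2_commute[of "ys ! p j" "ys ! p k"] by simp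
  next
    fix a assume a: "a \<in> ?S"
    obtain j k where jk: "a = (j,k)" "j < k" "k < n" using a by auto
    show "?f (?g a) = a" using jk by (auto simp: pinv)
    show "?g a \<in> ?S" using jk inv_lt ne[of j k] by auto
  qed
  then show ?thesis by (simp add: disc_roots_alt n flip: n_def)
qed

lemma proots_linear_prod:
  fixes xs :: "complex list"
  shows "proots (\<Prod>x\<leftarrow>xs. [:- x, 1:]) = mset xs"
proof (induction xs)
  case Nil then show ?case by simp
next
  case (Cons a xs)
  have "(\<Prod>x\<leftarrow>xs. [:- x, 1:]) \<noteq> 0" by (auto simp: prod_list_zero_iff)
  then show ?case using Cons by (simp add: proots_mult proots_linear_factor del: mult_pCons_left)
qed

lemma discriminant_power_poly:
  "discriminant (power_poly d \<alpha> n) = (\<Prod>j=1..d. \<Prod>k\<in>{j<..d}. (\<alpha> j ^ n - \<alpha> k ^ n)^2)"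
proof -
  define ys where "ys = map (\<lambda>j. \<alpha> (Suc j) ^ n) [0..<d]"
  have "power_poly d \<alpha> n = (\<Prod>j\<in>{0..<d}. [:- (\<alpha> (Suc j) ^ n), 1:])"
    unfolding power_poly_def
    by (rule prod.reindex_bij_witness[where i = Suc and j = "\<lambda>j. j - 1"]) auto
  also have "\<dots> = (\<Prod>x\<leftarrow>ys. [:- x, 1:])"
    by (simp add: ys_def o_def prod.list_conv_set_nth)
  finally have P: "power_poly d \<alpha> n = (\<Prod>x\<leftarrow>ys. [:- x, 1:])" .
  have lc: "Polynomial.lead_coeff (power_poly d \<alpha> n) = 1"
    by (simp add: power_poly_def lead_coeff_prod)
  have "mset (SOME xs. mset xs = proots (power_poly d \<alpha> n)) = mset ys"
    using someI[of "\<lambda>xs. mset xs = proots (power_poly d \<alpha> n)" ys]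
    by (simp add: P proots_linear_prod)
  then have "disc_roots (SOME xs. mset xs = proots (power_poly d \<alpha> n)) = disc_roots ys"
    by (rule disc_roots_cong)
  then have "discriminant (power_poly d \<alpha> n) = disc_roots ys"
    using lc by (simp add: discriminant_def)
  also have "\<dots> = (\<Prod>j<d. \<Prod>k\<in>{j<..<d}. (\<alpha> (Suc j) ^ n - \<alpha> (Suc k) ^ n)^2)"
    unfolding disc_roots_def by (intro prod.cong) (auto simp: ys_def)
  also have "\<dots> = (\<Prod>j=1..d. \<Prod>k\<in>{j<..d}. (\<alpha> j ^ n - \<alpha> k ^ n)^2)"
  proof (rule prod.reindex_bij_witness[where i = "\<lambda>j. j - 1" and j = Suc], goal_cases)
    case (5 j)
    show ?case
      by (rule prod.reindex_bij_witness[where j = "\<lambda>j. j - 1" and i = Suc]) auto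
  qed auto
  finally show ?thesis .
qed

text \<open>The subfield \<open>\<rat>(A)\<close> of \<open>\<complex>\<close>; every subfield of \<open>\<complex>\<close> contains \<open>\<rat>\<close>, so
  adjoining \<open>\<rat>\<close> explicitly is unnecessary.\<close>

definition rat_adjoin :: "complex set \<Rightarrow> complex set" where
  "rat_adjoin A = generate_field ring_of_type_algebra A"

definition ring_of_integers :: "complex set \<Rightarrow> complex ring" where
  "ring_of_integers K = ring_of_type_algebra \<lparr>carrier := {x \<in> K. algebraic_int x}\<rparr>"

end

theory Submission
  imports Defs "Jordan_Normal_Form.Char_Poly"
begin

text \<open>
  Since \<open>a\<^sub>0 = \<plusminus>1\<close>, each root \<open>\<alpha>\<^sub>j\<close> is a unit of \<open>R\<close>, so Lagrange's theorem in
  \<open>(R/mR)\<^sup>\<times>\<close> gives \<open>\<alpha>\<^sub>j\<^sup>n = 1 + m r\<^sub>j\<close> with \<open>r\<^sub>j\<close> an algebraic integer. Hence the discriminant is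
  \<open>m\<^sup>d\<^sup>(\<^sup>d\<^sup>-\<^sup>1\<^sup>)\<close> times the algebraic integer \<open>\<Prod> (r\<^sub>j - r\<^sub>k)\<^sup>2\<close>, and that factor is an integer as soon as
  it is rational. Rationality of the discriminant comes from Newton's identities used in both
  directions: the power sums of the \<open>\<alpha>\<^sub>j\<close> are rational, hence so are those of the numbers
  \<open>(\<alpha>\<^sub>j\<^sup>n - \<alpha>\<^sub>k\<^sup>n)\<^sup>2\<close> over all pairs \<open>j < k\<close>, hence so is the product of these numbers.
\<close>

section \<open>Algebraic integers via finitely generated modules over the integers\<close>

interpretation int_module: Modules.module "\<lambda>(k::int) (x::'a::comm_ring_1). of_int k * x"
  by unfold_locales (simp_all add: algebra_simps)

text \<open>Multiplication by \<open>z\<close> acts on the vector of generators through an integer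
  matrix. This vector is nonzero because of \<open>g\<^sub>0\<close>, so \<open>z\<close> is an
  eigenvalue and hence a root of the monic integral characteristic polynomial.\<close>

lemma algebraic_int_if_stable_int_span:
  fixes z :: "'a::field_char_0"
  assumes "finite G" and "g\<^sub>0 \<in> G" and "g\<^sub>0 \<noteq> 0"
    and stable: "\<And>g. g \<in> G \<Longrightarrow> z * g \<in> int_module.span G"
  shows "algebraic_int z"
proof -
  have "\<exists>u. z * g = (\<Sum>h\<in>G. of_int (u h) * h)" if "g \<in> G" for g
    using stable[OF that] int_module.span_finite[OF \<open>finite G\<close>] by auto
  then obtain u where u: "\<And>g. g \<in> G \<Longrightarrow> z * g = (\<Sum>h\<in>G. of_int (u g h) * h)"
    by metis
  obtain b where b: "bij_betw b {0..<card G} G"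
    using ex_bij_betw_nat_finite[OF \<open>finite G\<close>] by blast
  define n where "n = card G"
  define A where "A = mat n n (\<lambda>(i,j). u (b i) (b j))"
  define A' where "A' = map_mat (of_int :: int \<Rightarrow> 'a) A"
  define v where "v = vec n b"
  have A: "A \<in> carrier_mat n n" "A' \<in> carrier_mat n n"
    by (auto simp: A_def A'_def)
  have bG: "b i \<in> G" if "i < n" for i
    using b that by (auto simp: bij_betw_def n_def)
  obtain i\<^sub>0 where i0: "i\<^sub>0 < n" "b i\<^sub>0 = g\<^sub>0"
    using b assms(2) unfolding bij_betw_def n_def by (metis atLeastLessThan_iff imageE)
  \<comment> \<open>Row \<open>i\<close> is the relation \<open>u\<close> for the generator
    \<open>b i\<close>.\<close>
  have "A' *\<^sub>v v = z \<cdot>\<^sub>v v"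
  proof (rule eq_vecI)
    fix i assume "i < dim_vec (z \<cdot>\<^sub>v v)"
    then have i: "i < n" by (simp add: v_def)
    have "(A' *\<^sub>v v) $ i = (\<Sum>j\<in>{0..<n}. of_int (u (b i) (b j)) * b j)"
      using i by (simp add: A'_def A_def v_def scalar_prod_def)
    also have "\<dots> = (\<Sum>h\<in>G. of_int (u (b i) h) * h)"
      using sum.reindex_bij_betw[OF b] by (simp add: n_def)
    finally show "(A' *\<^sub>v v) $ i = (z \<cdot>\<^sub>v v) $ i"
      using u[OF bG[OF i]] i by (simp add: v_def)
  qed (simp add: A'_def A_def v_def)
  moreover have "v \<noteq> 0\<^sub>v n"
  proof
    assume "v = 0\<^sub>v n"
    then have "v $ i\<^sub>0 = 0" using i0 by simp
    then show False using i0 assms(3) by (simp add: v_def)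
  qed
  ultimately have "eigenvalue A' z"
    unfolding eigenvalue_def eigenvector_def using A
    by (intro exI[of _ v]) (auto simp: v_def)
  then have "poly (char_poly A') z = 0"
    using eigenvalue_root_char_poly[OF A(2)] by simp
  moreover have "char_poly A' = map_poly of_int (char_poly A)"
    unfolding A'_def by (rule of_int_hom.char_poly_hom[OF A(1)])
  moreover have "Polynomial.lead_coeff (char_poly A) = 1"
    using degree_monic_char_poly[OF A(1)] by simp
  ultimately show ?thesis
    unfolding algebraic_int_altdef_ipoly by auto
qed

text \<open>A monic integral equation for \<open>x\<close> is solved for its top power. Its degree
  is positive because the constant 1 has no root; this later puts 1 among the monomials.\<close>

lemma algebraic_int_power_in_int_span:
  fixes x :: "'a::field_char_0"
  assumes "algebraic_int x"
  obtains n where "n > 0" "x ^ n \<in> int_module.span ((\<lambda>i. x ^ i) ` {..<n})"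
proof -
  obtain p :: "int poly" where p: "poly (map_poly of_int p) x = 0" "Polynomial.lead_coeff p = 1"
    using assms by (auto simp: algebraic_int_altdef_ipoly)
  define n where "n = Polynomial.degree p"
  have "n > 0"
    using p by (intro Nat.gr0I) (auto simp: n_def elim!: degree_eq_zeroE)
  have "0 = (\<Sum>i\<le>n. of_int (Polynomial.coeff p i) * x ^ i)"
    using p(1) by (simp add: poly_altdef n_def degree_map_poly coeff_map_poly)
  also have "\<dots> = x ^ n + (\<Sum>i<n. of_int (Polynomial.coeff p i) * x ^ i)"
    using p(2) by (simp add: n_def lessThan_Suc_atMost[symmetric])
  finally have "x ^ n = - (\<Sum>i<n. of_int (Polynomial.coeff p i) * x ^ i)"
    by (simp add: eq_neg_iff_add_eq_0)
  also have "\<dots> \<in> int_module.span ((\<lambda>i. x ^ i) ` {..<n})"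
    by (intro int_module.span_neg int_module.span_sum int_module.span_scale int_module.span_base) auto
  finally show ?thesis using that \<open>n > 0\<close> by blast
qed

lemma int_span_mult_image:
  fixes c w :: "'a::comm_ring_1"
  assumes "w \<in> int_module.span S" and "\<And>x. x \<in> S \<Longrightarrow> c * x \<in> int_module.span T"
  shows "c * w \<in> int_module.span T"
  using assms(1)
proof (induction rule: int_module.span_induct_alt)
  case base
  show ?case using int_module.span_zero by simp
next
  case (step k x y)
  have "of_int k * (c * x) + c * y \<in> int_module.span T"
    using step assms(2) by (intro int_module.span_add int_module.span_scale) auto
  then show ?case by (simp add: algebra_simps)
qed

text \<open>The \<open>\<int>\<close>-module spanned by the monomials \<open>x\<^sup>i y\<^sup>j\<close> below the degrees of \<open>x\<close> and \<open>y\<close> is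
  stable under both \<open>x\<close> and \<open>y\<close>.\<close>

lemma
  fixes x y :: "'a::field_char_0"
  assumes "algebraic_int x" and "algebraic_int y"
  shows algebraic_int_add: "algebraic_int (x + y)"
    and algebraic_int_mult: "algebraic_int (x * y)"
proof -
  obtain a where a: "a > 0" "x ^ a \<in> int_module.span ((\<lambda>i. x ^ i) ` {..<a})"
    using algebraic_int_power_in_int_span[OF assms(1)] .
  obtain b where b: "b > 0" "y ^ b \<in> int_module.span ((\<lambda>i. y ^ i) ` {..<b})"
    using algebraic_int_power_in_int_span[OF assms(2)] .
  define G where "G = (\<lambda>(i,j). x ^ i * y ^ j) ` ({..<a} \<times> {..<b})"
  have G: "x ^ i * y ^ j \<in> int_module.span G" if "i < a" "j < b" for i j
    using that by (intro int_module.span_base) (auto simp: G_def)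
  have x: "x * g \<in> int_module.span G" if "g \<in> G" for g
  proof -
    obtain i j where ij: "i < a" "j < b" "g = x ^ i * y ^ j"
      using \<open>g \<in> G\<close> by (auto simp: G_def)
    show ?thesis
    proof (cases "Suc i < a")
      case True
      then show ?thesis using G[of "Suc i" j] ij by (simp add: mult_ac)
    next
      case False
      \<comment> \<open>The exponent of \<open>x\<close> has reached \<open>a\<close>; the relation
        for \<open>x ^ a\<close>, multiplied by \<open>y ^ j\<close>, brings it back down.\<close>
      then have "a = Suc i" using ij by simp
      moreover have "y ^ j * x ^ a \<in> int_module.span G"
        using a(2) by (rule int_span_mult_image) (use G ij in \<open>auto simp: mult.commute\<close>)
      ultimately show ?thesis by (simp add: ij mult_ac)
    qed
  qed
  have y: "y * g \<in> int_module.span G" if "g \<in> G" for g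
  proof -
    obtain i j where ij: "i < a" "j < b" "g = x ^ i * y ^ j"
      using \<open>g \<in> G\<close> by (auto simp: G_def)
    show ?thesis
    proof (cases "Suc j < b")
      case True
      then show ?thesis using G[of i "Suc j"] ij by (simp add: mult_ac)
    next
      case False
      then have "b = Suc j" using ij by simp
      moreover have "x ^ i * y ^ b \<in> int_module.span G"
        using b(2) by (rule int_span_mult_image) (use G ij in auto)
      ultimately show ?thesis by (simp add: ij mult_ac)
    qed
  qed
  have fin: "finite G" and one: "1 \<in> G"
    using a(1) b(1) by (auto simp: G_def intro!: image_eqI[of _ _ "(0,0)"])
  show "algebraic_int (x + y)"
    using fin one by (rule algebraic_int_if_stable_int_span)
      (auto simp: distrib_right intro: int_module.span_add x y)
  have "x * (y * g) \<in> int_module.span G" if "g \<in> G" for g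
    using y[OF that] x by (rule int_span_mult_image)
  then show "algebraic_int (x * y)"
    using fin one by (intro algebraic_int_if_stable_int_span) (auto simp: mult.assoc)
qed

lemma algebraic_int_power:
  fixes x :: "'a::field_char_0"
  shows "algebraic_int x \<Longrightarrow> algebraic_int (x ^ k)"
  by (induction k) (simp_all add: algebraic_int_mult)

lemma algebraic_int_prod:
  fixes f :: "'i \<Rightarrow> 'a::field_char_0"
  shows "(\<And>i. i \<in> I \<Longrightarrow> algebraic_int (f i)) \<Longrightarrow> algebraic_int (\<Prod>i\<in>I. f i)"
  by (induction I rule: infinite_finite_induct) (simp_all add: algebraic_int_mult)

section \<open>Newton's identities and rationality of the discriminant\<close>

text \<open>The sum of all \<open>q / (1 - y i * X)\<close> is computed twice: by geometric series
  its coefficients are convolutions of those of \<open>q\<close> with the power sums, and by the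
  product rule it equals \<open>card I * q - X * q'\<close>.\<close>

lemma newton_identity:
  fixes y :: "'i \<Rightarrow> 'a::idom"
  assumes "finite I"
  defines "q \<equiv> \<Prod>i\<in>I. [:1, - y i:]"
  shows "(\<Sum>l\<le>k. Polynomial.coeff q l * (\<Sum>i\<in>I. y i ^ (k - l))) =
     (of_nat (card I) - of_nat k) * Polynomial.coeff q k"
proof -
  define r where "r i = (\<Prod>j\<in>I - {i}. [:1, - y j:])" for i
  have q: "q = [:1, - y i:] * r i" if "i \<in> I" for i
    unfolding q_def r_def by (rule prod.remove[OF assms(1) that])
  \<comment> \<open>\<open>q / (1 - y\<^sub>i X) = r\<^sub>i\<close>, read off with the geometric series\<close>
  have geom: "(\<Sum>l\<le>k. Polynomial.coeff q l * y i ^ (k - l)) = Polynomial.coeff (r i) k"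
    if "i \<in> I" for i k
  proof (induction k)
    case 0
    show ?case using q[OF that] by simp
  next
    case (Suc k)
    have "(\<Sum>l\<le>Suc k. Polynomial.coeff q l * y i ^ (Suc k - l)) =
       y i * (\<Sum>l\<le>k. Polynomial.coeff q l * y i ^ (k - l)) + Polynomial.coeff q (Suc k)"
      by (simp add: sum_distrib_left Suc_diff_le mult_ac)
    also have "Polynomial.coeff q (Suc k) = Polynomial.coeff (r i) (Suc k) - y i * Polynomial.coeff (r i) k"
      by (subst q[OF that]) simp
    finally show ?case using Suc by simp
  qed
  have "pderiv q = (\<Sum>i\<in>I. r i * [:- y i:])"
    unfolding q_def r_def by (simp add: pderiv_prod pderiv_pCons)
  \<comment> \<open>\<open>pCons 0\<close> multiplies by \<open>X\<close>, which turns each summand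
    into \<open>- y i * X * r i = q - r i\<close> and so lets the sum of the \<open>r i\<close> be
    isolated.\<close>
  then have "pCons 0 (pderiv q) = (\<Sum>i\<in>I. [:0, - y i:] * r i)"
  proof -
    assume "pderiv q = (\<Sum>i\<in>I. r i * [:- y i:])"
    then have "[:0, 1:] * pderiv q = (\<Sum>i\<in>I. [:0, 1:] * (r i * [:- y i:]))"
      by (simp only: sum_distrib_left)
    also have "\<dots> = (\<Sum>i\<in>I. [:0, - y i:] * r i)"
      by (intro sum.cong refl) simp
    finally show ?thesis by simp
  qed
  also have "\<dots> = (\<Sum>i\<in>I. q - r i)"
    by (intro sum.cong refl) (simp add: q)
  finally have "(\<Sum>i\<in>I. r i) = of_nat (card I) * q - pCons 0 (pderiv q)"
    by (simp add: sum_subtractf)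
  moreover have "Polynomial.coeff (pCons 0 (pderiv q)) k = of_nat k * Polynomial.coeff q k"
    by (cases k) (simp_all add: coeff_pderiv)
  ultimately have "Polynomial.coeff (\<Sum>i\<in>I. r i) k =
      (of_nat (card I) - of_nat k) * Polynomial.coeff q k"
    by (simp only: of_nat_poly coeff_diff) (simp add: algebra_simps)
  moreover have "(\<Sum>l\<le>k. Polynomial.coeff q l * (\<Sum>i\<in>I. y i ^ (k - l))) =
      (\<Sum>i\<in>I. \<Sum>l\<le>k. Polynomial.coeff q l * y i ^ (k - l))"
    unfolding sum_distrib_left by (rule sum.swap)
  ultimately show ?thesis by (simp add: geom coeff_sum)
qed

text \<open>The degree drops below \<open>card I\<close> when some \<open>y i\<close> is zero, so
  the induction relies only on an upper bound for it.\<close>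

lemma coeff_prod_linear:
  fixes y :: "'i \<Rightarrow> 'a::comm_ring_1"
  assumes "finite I"
  shows "Polynomial.coeff (\<Prod>i\<in>I. [:1, - y i:]) (card I) = (\<Prod>i\<in>I. - y i)"
  using assms
proof (induction I rule: finite_induct)
  case (insert a I)
  have "Polynomial.degree (\<Prod>i\<in>I. [:1, - y i:]) \<le> (\<Sum>i\<in>I. Polynomial.degree [:1, - y i:])"
    using degree_prod_sum_le[OF insert(1), of "\<lambda>i. [:1, - y i:]"] by (simp add: o_def)
  also have "\<dots> \<le> (\<Sum>i\<in>I. 1)"
    by (rule sum_mono) simp
  finally have "Polynomial.coeff (\<Prod>i\<in>I. [:1, - y i:]) (Suc (card I)) = 0"
    by (intro coeff_eq_0) simp
  then show ?case using insert by simp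
qed simp

text \<open>Newton's identity is solved for the coefficients of \<open>q\<close>, dividing by
  \<open>k\<close>; the coefficient at \<open>card I\<close> is the product up to sign.\<close>

lemma prod_in_Rats_if_power_sums_in_Rats:
  fixes y :: "'i \<Rightarrow> 'a::field_char_0"
  assumes "finite I" and p: "\<And>k. (\<Sum>i\<in>I. y i ^ k) \<in> \<rat>"
  shows "(\<Prod>i\<in>I. y i) \<in> \<rat>"
proof -
  define q where "q = (\<Prod>i\<in>I. [:1, - y i:])"
  have "Polynomial.coeff q k \<in> \<rat>" for k
  proof (induction k rule: less_induct)
    case (less k)
    show ?case
    proof (cases "k = 0")
      case True
      then show ?thesis by (simp add: q_def poly_prod flip: poly_0_coeff_0)
    next
      case False
      \<comment> \<open>The term \<open>l = k\<close> contains the zeroth power sum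
        \<open>card I\<close> and cancels against the right-hand side.\<close>
      have "(\<Sum>l<k. Polynomial.coeff q l * (\<Sum>i\<in>I. y i ^ (k - l))) = - (of_nat k * Polynomial.coeff q k)"
        using newton_identity[OF assms(1), of y k, folded q_def]
        by (simp add: lessThan_Suc_atMost[symmetric] algebra_simps eq_neg_iff_add_eq_0)
      then have "Polynomial.coeff q k =
          - (\<Sum>l<k. Polynomial.coeff q l * (\<Sum>i\<in>I. y i ^ (k - l))) / of_nat k"
        using False by simp
      also have "\<dots> \<in> \<rat>"
        using less p by (intro Rats_divide Rats_minus_iff[THEN iffD2] Rats_sum[of "{..<k}"] Rats_mult) simp_all
      finally show ?thesis .
    qed
  qed
  then have "(-1) ^ card I * Polynomial.coeff q (card I) \<in> \<rat>"
    by (intro Rats_mult Rats_power) auto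
  then show ?thesis
    by (simp add: q_def coeff_prod_linear[OF assms(1)] prod_uminus flip: power_mult_distrib mult.assoc)
qed

text \<open>The converse direction: the term \<open>l = 0\<close> has coefficient 1, so each power
  sum is determined by the coefficients and the earlier power sums.\<close>

lemma power_sums_in_Rats_if_coeffs_in_Rats:
  fixes y :: "'i \<Rightarrow> 'a::field_char_0"
  assumes "finite I" and q: "\<And>k. Polynomial.coeff (\<Prod>i\<in>I. [:1, - y i:]) k \<in> \<rat>"
  shows "(\<Sum>i\<in>I. y i ^ k) \<in> \<rat>"
proof (induction k rule: less_induct)
  case (less k)
  define q where "q = (\<Prod>i\<in>I. [:1, - y i:])"
  have q0: "Polynomial.coeff q 0 = 1"
    by (simp add: q_def poly_prod flip: poly_0_coeff_0)
  have "(\<Sum>i\<in>I. y i ^ k) + (\<Sum>l\<in>{0<..k}. Polynomial.coeff q l * (\<Sum>i\<in>I. y i ^ (k - l))) =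
      (\<Sum>l\<le>k. Polynomial.coeff q l * (\<Sum>i\<in>I. y i ^ (k - l)))"
    using q0 by (simp add: sum.head atMost_atLeast0)
  also have "\<dots> = (of_nat (card I) - of_nat k) * Polynomial.coeff q k"
    unfolding q_def by (rule newton_identity[OF assms(1)])
  finally have "(\<Sum>i\<in>I. y i ^ k) = (of_nat (card I) - of_nat k) * Polynomial.coeff q k -
      (\<Sum>l\<in>{0<..k}. Polynomial.coeff q l * (\<Sum>i\<in>I. y i ^ (k - l)))"
    by (simp add: algebra_simps)
  also have "\<dots> \<in> \<rat>"
    using less q by (intro Rats_diff Rats_mult Rats_sum[of "{0<..k}"]) (simp_all add: q_def)
  finally show ?case .
qed

text \<open>Swapping the indices maps the part below the diagonal onto the part above it.\<close>

lemma sum_greater_pairs: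
  fixes d :: nat and f :: "nat \<Rightarrow> nat \<Rightarrow> 'a::comm_monoid_add"
  assumes "\<And>j k. f j k = f k j"
  shows "(\<Sum>j=1..d. \<Sum>k=1..d. f j k) =
    (\<Sum>j=1..d. f j j) + ((\<Sum>j=1..d. \<Sum>k\<in>{j<..d}. f j k) + (\<Sum>j=1..d. \<Sum>k\<in>{j<..d}. f j k))"
proof -
  have "(\<Sum>j=1..d. \<Sum>k\<in>{1..<j}. f j k) = (\<Sum>j=1..d. \<Sum>k\<in>{j<..d}. f k j)"
    unfolding sum.Sigma[OF finite_atLeastAtMost ballI[OF finite_atLeastLessThan]]
      sum.Sigma[OF finite_atLeastAtMost ballI[OF finite_greaterThanAtMost]]
    by (rule sum.reindex_bij_witness[where i = prod.swap and j = prod.swap]) auto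
  moreover have "(\<Sum>k=1..d. f j k) = (f j j + (\<Sum>k\<in>{j<..d}. f j k)) + (\<Sum>k\<in>{1..<j}. f j k)"
    if "j \<in> {1..d}" for j
  proof -
    have "{1..d} = insert j {j<..d} \<union> {1..<j}" using that by auto
    then show ?thesis by (simp only:) (subst sum.union_disjoint; auto)
  qed
  ultimately show ?thesis
    using assms by (simp add: sum.distrib add.assoc)
qed

text \<open>It suffices that the power sums of the squared differences over pairs
  \<open>j < k\<close> are rational. By symmetry these come from sums over all pairs
  \<open>(j,k)\<close>, which factor into power sums of the \<alpha>'s.\<close>

lemma disc_power_in_Rats:
  fixes \<alpha> :: "nat \<Rightarrow> 'a::field_char_0"
  assumes p: "\<And>k. (\<Sum>j=1..d. \<alpha> j ^ k) \<in> \<rat>"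
  shows "(\<Prod>j=1..d. \<Prod>k\<in>{j<..d}. (\<alpha> j ^ n - \<alpha> k ^ n)\<^sup>2) \<in> \<rat>"
proof -
  define f where "f r j k = ((\<alpha> j ^ n - \<alpha> k ^ n)\<^sup>2) ^ r" for r j k
  have all: "(\<Sum>j=1..d. \<Sum>k=1..d. f r j k) \<in> \<rat>" for r
  proof -
    \<comment> \<open>The binomial expansion of the \<open>2*r\<close>-th power separates
      \<open>j\<close> from \<open>k\<close>.\<close>
    have "f r j k = (\<Sum>t\<le>2*r. of_nat (2*r choose t) * \<alpha> j ^ (n * t) * ((-1) ^ (2*r-t) * \<alpha> k ^ (n * (2*r-t))))"
      for j k
      using binomial_ring[of "\<alpha> j ^ n" "- (\<alpha> k ^ n)" "2*r"]
      by (simp add: f_def power_mult[symmetric] power_minus[of "\<alpha> k ^ _"])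
    then have "(\<Sum>j=1..d. \<Sum>k=1..d. f r j k) = (\<Sum>j=1..d. \<Sum>t\<le>2*r. \<Sum>k=1..d.
        of_nat (2*r choose t) * \<alpha> j ^ (n * t) * ((-1) ^ (2*r-t) * \<alpha> k ^ (n * (2*r-t))))"
      by (simp only: sum.swap[of _ "{..2*r}"])
    also have "\<dots> = (\<Sum>t\<le>2*r. \<Sum>j=1..d. \<Sum>k=1..d.
        of_nat (2*r choose t) * \<alpha> j ^ (n * t) * ((-1) ^ (2*r-t) * \<alpha> k ^ (n * (2*r-t))))"
      by (rule sum.swap)
    also have "\<dots> = (\<Sum>t\<le>2*r. of_nat (2*r choose t) * (-1) ^ (2*r-t) *
        (\<Sum>j=1..d. \<alpha> j ^ (n * t)) * (\<Sum>k=1..d. \<alpha> k ^ (n * (2*r-t))))"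
      by (simp only: sum_distrib_left sum_distrib_right mult_ac)
    also have "\<dots> \<in> \<rat>"
      using p by (intro Rats_sum[of "{..2*r}"] Rats_mult) simp_all
    finally show ?thesis .
  qed
  \<comment> \<open>Diagonal terms vanish except for \<open>r = 0\<close>, where
    \<open>0 ^ 0 = 1\<close>.\<close>
  have diag: "(\<Sum>j=1..d. f r j j) \<in> \<rat>" for r
    by (intro Rats_sum) (simp add: f_def power_0_left)
  have half: "(\<Sum>j=1..d. \<Sum>k\<in>{j<..d}. f r j k) \<in> \<rat>" (is "?S \<in> _") for r
  proof -
    have "?S = ((\<Sum>j=1..d. \<Sum>k=1..d. f r j k) - (\<Sum>j=1..d. f r j j)) / 2"
      by (subst sum_greater_pairs) (auto simp: f_def power2_commute)
    then show ?thesis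
      using all diag by (simp only:) (intro Rats_divide Rats_diff Rats_number_of)
  qed
  define I where "I = Sigma {1..d} (\<lambda>j. {j<..d})"
  have "(\<Prod>jk\<in>I. case jk of (j,k) \<Rightarrow> (\<alpha> j ^ n - \<alpha> k ^ n)\<^sup>2) \<in> \<rat>"
  proof (rule prod_in_Rats_if_power_sums_in_Rats)
    fix r
    show "(\<Sum>jk\<in>I. (case jk of (j,k) \<Rightarrow> (\<alpha> j ^ n - \<alpha> k ^ n)\<^sup>2) ^ r) \<in> \<rat>"
      using half[of r] unfolding I_def f_def
      by (subst (asm) sum.Sigma) (auto simp: case_prod_unfold)
  qed (simp add: I_def)
  then show ?thesis
    unfolding I_def by (subst prod.Sigma) auto
qed

lemma power_sums_of_roots_in_Rats:
  fixes P :: "int poly" and \<alpha> :: "nat \<Rightarrow> 'a::field_char_0"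
  assumes "map_poly of_int P = (\<Prod>j=1..d. [:- \<alpha> j, 1:])"
  shows "(\<Sum>j=1..d. \<alpha> j ^ k) \<in> \<rat>"
proof (rule power_sums_in_Rats_if_coeffs_in_Rats)
  fix k
  \<comment> \<open>For a zero root both sides are the constant 1.\<close>
  have "reflect_poly [:- \<alpha> j, 1:] = [:1, - \<alpha> j:]" for j
    by (cases "\<alpha> j = 0") (simp_all add: reflect_poly_def)
  then have "(\<Prod>j=1..d. [:1, - \<alpha> j:]) = reflect_poly (map_poly of_int P)"
    by (simp add: assms reflect_poly_prod)
  then show "Polynomial.coeff (\<Prod>j=1..d. [:1, - \<alpha> j:]) k \<in> \<rat>"
    by (simp add: coeff_reflect_poly coeff_map_poly)
qed simp

section \<open>Units of the ring of integers modulo \<open>m\<close>\<close>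

lemma subcring_algebraic_ints:
  assumes "subfield K (ring_of_type_algebra :: complex ring)"
  shows "subcring {x \<in> K. algebraic_int x} (ring_of_type_algebra :: complex ring)"
proof -
  interpret field "ring_of_type_algebra :: complex ring" by (rule field_from_type_algebra)
  interpret K: subfield K "ring_of_type_algebra :: complex ring" by (rule assms)
  have *: "a \<oplus>\<^bsub>ring_of_type_algebra\<^esub> b = a + b" "a \<otimes>\<^bsub>ring_of_type_algebra\<^esub> b = a * b"
    "\<one>\<^bsub>ring_of_type_algebra\<^esub> = 1" "carrier ring_of_type_algebra = UNIV" for a b :: complex
    by (simp_all add: ring_of_type_algebra_def)
  have neg: "\<ominus>\<^bsub>ring_of_type_algebra\<^esub> a = - a" for a :: complex
    by (rule minus_equality) (simp_all add: ring_of_type_algebra_def)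
  note closed = subringE[OF K.subring_axioms, unfolded * neg]
  show ?thesis
    by (intro subcringI' subringI)
      (simp_all add: * neg closed algebraic_int_add algebraic_int_mult)
qed

text \<open>The coset of a unit is a unit of the quotient, so Lagrange's theorem in the unit group
  makes its \<open>n\<close>-th power trivial.\<close>

lemma (in cring) unit_power_minus_one_in_ideal:
  assumes "ideal I R" and "u \<in> Units R"
    and "card (Units (R Quot I)) dvd n" and "n > 0"
  shows "u [^] n \<ominus> \<one> \<in> I"
proof -
  interpret I: ideal I R by fact
  interpret Q: cring "R Quot I" by (rule I.quotient_is_cring) (rule is_cring)
  interpret h: ring_hom_cring R "R Quot I" "(+>) I"
    by (rule I.rcos_ring_hom_cring) (rule is_cring)
  \<comment> \<open>An infinite unit group would have \<open>card\<close> 0, which does not divide \<open>n > 0\<close>.\<close>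
  have fin: "finite (Units (R Quot I))"
    using assms(3,4) by (metis card.infinite dvd_0_left_iff less_irrefl)
  have u: "u \<in> carrier R" and v: "inv u \<in> carrier R" using assms(2) by auto
  have "(I +> u) \<otimes>\<^bsub>R Quot I\<^esub> (I +> inv u) = \<one>\<^bsub>R Quot I\<^esub>"
    using h.hom_mult[OF u v] assms(2) h.hom_one by simp
  moreover have "(I +> inv u) \<otimes>\<^bsub>R Quot I\<^esub> (I +> u) = \<one>\<^bsub>R Quot I\<^esub>"
    using h.hom_mult[OF v u] assms(2) h.hom_one by simp
  ultimately have U: "I +> u \<in> Units (R Quot I)"
    using h.hom_closed[OF u] h.hom_closed[OF v] unfolding Units_def by blast
  obtain c where c: "n = card (Units (R Quot I)) * c" using assms(3) by auto
  have "I +> (u [^] n) = (I +> u) [^]\<^bsub>R Quot I\<^esub> n"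
    using u by simp
  also have "\<dots> = ((I +> u) [^]\<^bsub>R Quot I\<^esub> card (Units (R Quot I))) [^]\<^bsub>R Quot I\<^esub> c"
    unfolding c using h.hom_closed[OF u] by (simp add: Q.nat_pow_pow)
  also have "\<dots> = I +> \<one>"
    using Q.units_power_order_eq_one[OF fin U] h.hom_one by simp
  finally have "I +> (u [^] n) = I +> \<one>" .
  then show ?thesis
    using quotient_eq_iff_same_a_r_cos[OF assms(1), of "u [^] n" \<one>] u by simp
qed

text \<open>Integrality of both \<open>x\<close> and its inverse makes \<open>x\<close> a unit of
  the ring of integers; the congruence modulo the principal ideal is then translated into complex
  arithmetic.\<close>

lemma unit_power_congruent_one:
  fixes m :: int and K :: "complex set"
  assumes "subfield K ring_of_type_algebra"
    and "x \<in> K" and "x \<noteq> 0" and "algebraic_int x" and "algebraic_int (inverse x)"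
    and "card (Units (ring_of_integers K Quot (PIdl\<^bsub>ring_of_integers K\<^esub> (of_int m)))) dvd n"
    and "n > 0"
  obtains r where "algebraic_int r" "x ^ n - 1 = of_int m * r"
proof -
  define RK where "RK = {x \<in> K. algebraic_int x}"
  define R where "R = ring_of_integers K"
  interpret L: field "ring_of_type_algebra :: complex ring" by (rule field_from_type_algebra)
  have sub: "subcring RK ring_of_type_algebra"
    unfolding RK_def by (rule subcring_algebraic_ints) fact
  have R: "R = ring_of_type_algebra\<lparr>carrier := RK\<rparr>"
    by (simp add: R_def ring_of_integers_def RK_def)
  interpret cring R
    unfolding R using sub L.subcring_iff subringE(1) subcringE(1) by metis
  have ops: "a \<oplus>\<^bsub>R\<^esub> b = a + b" "a \<otimes>\<^bsub>R\<^esub> b = a * b" "\<one>\<^bsub>R\<^esub> = 1" "\<zero>\<^bsub>R\<^esub> = 0" "carrier R = RK" for a b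
    by (simp_all add: R ring_of_type_algebra_def)
  have pow: "a [^]\<^bsub>R\<^esub> k = a ^ k" for a and k :: nat
    by (induction k) (simp_all add: ops)
  have "inverse x \<in> K"
  proof -
    have x: "x \<in> K - {\<zero>\<^bsub>ring_of_type_algebra\<^esub>}"
      using assms(2,3) by (simp add: ring_of_type_algebra_def)
    have "x * inv\<^bsub>ring_of_type_algebra\<^esub> x = 1"
      using L.subfield_m_inv(2)[OF assms(1) x] by (simp add: ring_of_type_algebra_def)
    then show ?thesis
      using L.subfield_m_inv(1)[OF assms(1) x] by (simp add: inverse_unique)
  qed
  then have "x \<in> RK" "inverse x \<in> RK"
    using assms by (auto simp: RK_def)
  then have unit: "x \<in> Units R"
    using assms(3) by (auto simp: Units_def ops intro!: bexI[of _ "inverse x"])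
  have "of_nat k \<in> carrier R" for k
    by (induction k) (use zero_closed one_closed a_closed in \<open>simp_all add: ops\<close>)
  moreover have neg: "- a \<in> carrier R" if "a \<in> carrier R" for a
  proof -
    have "\<ominus>\<^bsub>R\<^esub> a + a = 0" using l_neg[OF that] by (simp add: ops)
    then show ?thesis using a_inv_closed[OF that] by (metis eq_neg_iff_add_eq_0)
  qed
  ultimately have m: "of_int m \<in> carrier R"
    by (cases m) (auto simp del: of_nat_Suc simp: of_int_minus)
  have "x [^]\<^bsub>R\<^esub> n \<ominus>\<^bsub>R\<^esub> \<one>\<^bsub>R\<^esub> \<in> PIdl\<^bsub>R\<^esub> (of_int m)"
    using unit_power_minus_one_in_ideal[OF cgenideal_ideal[OF m] unit] assms(6,7)
    by (simp add: R_def)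
  then obtain r where r: "r \<in> RK" "x [^]\<^bsub>R\<^esub> n \<ominus>\<^bsub>R\<^esub> \<one>\<^bsub>R\<^esub> = r * of_int m"
    by (auto simp: cgenideal_def ops)
  \<comment> \<open>Adding 1 back eliminates the abstract subtraction of \<open>R\<close>, leaving
    operations that \<open>ops\<close> and \<open>pow\<close> identify with those of the complex
    numbers.\<close>
  have "(x [^]\<^bsub>R\<^esub> n \<ominus>\<^bsub>R\<^esub> \<one>\<^bsub>R\<^esub>) \<oplus>\<^bsub>R\<^esub> \<one>\<^bsub>R\<^esub> = x [^]\<^bsub>R\<^esub> n"
    using unit Units_closed by (simp add: minus_eq a_assoc l_neg)
  then have "r * of_int m + 1 = x ^ n"
    unfolding r(2) by (simp add: ops pow)
  then show ?thesis
    using r(1) by (intro that[of r]) (auto simp: RK_def algebra_simps)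
qed

section \<open>Extracting the power of \<open>m\<close> from the discriminant\<close>

theorem theorem8p4:
  fixes P :: "int poly" and d n :: nat and m :: int
    and \<alpha> :: "nat \<Rightarrow> complex" and K :: "complex set" and R :: "complex ring"
  assumes "Polynomial.lead_coeff P = 1" and "Polynomial.degree P = d"
    and "Polynomial.coeff P 0 = 1 \<or> Polynomial.coeff P 0 = -1"
    and "map_poly of_int P = (\<Prod>j=1..d. [:- \<alpha> j, 1:])"
    and "K = rat_adjoin (\<alpha> ` {1..d})"
    and "R = ring_of_integers K"
    and "m > 1" and "n > 0"
    and "card (Units (R Quot (PIdl\<^bsub>R\<^esub> (of_int m)))) dvd n"
  shows "\<exists>D :: int. of_int D = discriminant (power_poly d \<alpha> n) \<and> m ^ (d * (d - 1)) dvd D"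
proof -
  have field: "field (ring_of_type_algebra :: complex ring)" by (rule field_from_type_algebra)
  have K: "subfield K ring_of_type_algebra"
    unfolding assms(5) rat_adjoin_def
    by (rule field.generate_field_is_subfield[OF field]) (simp add: ring_of_type_algebra_def)
  have unit: "\<exists>r. algebraic_int r \<and> \<alpha> j ^ n - 1 = of_int m * r" if j: "j \<in> {1..d}" for j
  proof -
    have root: "poly (map_poly of_int P) (\<alpha> j) = 0"
      using j by (auto simp: assms(4) poly_prod)
    have "\<alpha> j \<in> K"
      unfolding assms(5) rat_adjoin_def using j by (auto intro: generate_field.incl)
    moreover have "\<alpha> j \<noteq> 0"
      using root assms(3) by (auto simp: poly_0_coeff_0 coeff_map_poly)
    moreover have "algebraic_int (\<alpha> j)"
      using root assms(1) by (auto simp: algebraic_int_altdef_ipoly)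
    moreover have "algebraic_int (inverse (\<alpha> j))"
    proof (rule algebraic_int_inverse)
      \<comment> \<open>Since the constant coefficient of \<open>P\<close> squares to 1, this
        multiple has constant coefficient 1; its reversal is monic with the inverse of
        \<open>\<alpha> j\<close> as a root.\<close>
      let ?p = "Polynomial.smult (of_int (Polynomial.coeff P 0)) (map_poly of_int P) :: complex poly"
      show "poly ?p (\<alpha> j) = 0" using root by simp
      show "\<forall>i. Polynomial.coeff ?p i \<in> \<int>" by (simp add: coeff_map_poly)
      show "Polynomial.coeff ?p 0 = 1" using assms(3) by (auto simp: coeff_map_poly)
    qed
    ultimately show ?thesis
      using unit_power_congruent_one[OF K, of "\<alpha> j" m n] assms(6,8,9) by metis
  qed
  then obtain r where r: "\<And>j. j \<in> {1..d} \<Longrightarrow> algebraic_int (r j)"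
    "\<And>j. j \<in> {1..d} \<Longrightarrow> \<alpha> j ^ n = 1 + of_int m * r j"
    by (metis add_diff_cancel_left' diff_add_cancel add.commute)
  define D where "D = discriminant (power_poly d \<alpha> n)"
  define E where "E = (\<Prod>j=1..d. \<Prod>k\<in>{j<..d}. (r j - r k)\<^sup>2)"
  have D: "D = (\<Prod>j=1..d. \<Prod>k\<in>{j<..d}. (\<alpha> j ^ n - \<alpha> k ^ n)\<^sup>2)"
    unfolding D_def by (rule discriminant_power_poly)
  also have "\<dots> = (\<Prod>j=1..d. \<Prod>k\<in>{j<..d}. of_int m ^ 2 * (r j - r k)\<^sup>2)"
    by (intro prod.cong refl) (simp add: r(2) power_mult_distrib flip: right_diff_distrib)
  also have "\<dots> = of_int m ^ (2 * (\<Sum>j=1..d. d - j)) * E"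
    by (simp add: prod.distrib E_def power_sum sum_distrib_left flip: power_mult)
  \<comment> \<open>Each of the \<open>d * (d - 1) / 2\<close> pairs contributes
    \<open>m ^ 2\<close>. Evenness cancels the \<open>div 2\<close> of the closed form.\<close>
  also have "2 * (\<Sum>j=1..d. d - j) = d * (d - 1)"
  proof -
    have "(\<Sum>j=1..d. d - j) = (\<Sum>i<d. i)"
      by (rule sum.reindex_bij_witness[where i = "\<lambda>i. d - i" and j = "\<lambda>j. d - j"]) auto
    moreover have "even (d * (d - 1))" by (cases d) auto
    ultimately show ?thesis by (simp add: Sum_Ico_nat lessThan_atLeast0)
  qed
  finally have DE: "D = of_int (m ^ (d * (d - 1))) * E" by simp
  have "D \<in> \<rat>"
    unfolding D by (rule disc_power_in_Rats[OF power_sums_of_roots_in_Rats[OF assms(4)]])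
  \<comment> \<open>Dividing by the nonzero power of \<open>m\<close> transfers rationality from
    \<open>D\<close> to \<open>E\<close>; integrality of \<open>E\<close> comes separately from the
    \<open>r j\<close>.\<close>
  moreover have "E = D / of_int (m ^ (d * (d - 1)))"
    using DE assms(7) by simp
  ultimately have "E \<in> \<rat>"
    by (simp only:) (intro Rats_divide Rats_of_int)
  moreover have "algebraic_int E"
  proof -
    have "algebraic_int (r j - r k)" if "j \<in> {1..d}" "k \<in> {1..d}" for j k
      using algebraic_int_add[of "r j" "- r k"] r(1) that by simp
    then show ?thesis
      unfolding E_def by (intro algebraic_int_prod algebraic_int_power) auto
  qed
  ultimately obtain e where "E = of_int e"
    using rational_algebraic_int_is_int by (auto elim: Ints_cases)
  then show ?thesis
    using DE by (intro exI[of _ "m ^ (d * (d - 1)) * e"]) (simp add: D_def)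
qed

end
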